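(* On $\mathbb{R}^2$ with coordinates $(x,y)$, let $X_{0,0}=\partial_x$ and $$X_{1,3}=-y(3x^2-y^2)\,\partial_x+x(x^2-3y^2)\,\partial_y.$$ For every $n\ge1$, let $\mathcal{M}=\mathcal{M}^n(\mathbb{R}^2)$ be the $n$-landmark manifold and let $\mathcal{E}=\operatorname{span}\{\ell X_{0,0},\ell X_{1,3}\}\subseteq T\mathcal{M}$. Then there is complete controllability on $\mathcal{M}$ with respect to $\mathcal{E}$ (for every $n$).
   Context: The landmark manifold is the open set $\mathcal{M}^n(\mathbb{R}^d)=\{\mathbf{x}=(x_1,\dots,x_n): x_i\in\mathbb{R}^d,\ x_{i_1}\ne x_{i_2}\text{ whenever } i_1\neq i_2\}\subseteq(\mathbb{R}^d)^n$. For a vector field $X$ on $\mathbb{R}^d$, $\ell X$ is the vector field on $\mathcal{M}^n(\mathbb{R}^d)$ given by $\ell X(x_1,\dots,x_n)=(X(x_1),\dots,X(x_n))$. Here $d=2$. The span of vector fields is taken pointwise: $\mathcal{E}_{\mathbf{x}}=\operatorname{span}_{\mathbb{R}}\{\ell X_{0,0}(\mathbf{x}),\ell X_{1,3}(\mathbf{x})\}$. An absolutely continuous curve $\gamma:[0,1]\to M$ in a manifold $M$ is horizontal with respect to $\mathcal{E}\subseteq TM$ if $\dot\gamma(t)\in\mathcal{E}_{\gamma(t)}$ for almost every $t$. The orbit $O_q$ of $\mathcal{E}$ at $q\in M$ is the set of $p\in M$ for which there is a horizontal curve $\gamma$ with $\gamma(0)=q$, $\gamma(1)=p$. Complete controllability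 on $M$ with respect to $\mathcal{E}$ means $O_q=M$ for every $q\in M$. When $\mathcal{E}$ is spanned by vector fields $Z_1,\dots,Z_m$, the orbit $O_q$ is also described as the set of all points $e^{t_1Z_{i_1}}\circ\cdots\circ e^{t_lZ_{i_l}}(q)$ with $t_j\in\mathbb{R}$, $i_j\in\{1,\dots,m\}$, $l\ge1$, where $e^{tZ}$ is the (local) flow of $Z$. *)

theory Defs
  imports "HOL-Analysis.Analysis"
begin

text \<open>A configuration of landmarks in \<open>\<real>\<^sup>d\<close> is an element \<open>x\<close> of \<open>real ^ 'd ^ 'n\<close>, with \<open>n = CARD('n)\<close>;
  \<open>x $ i\<close> is the \<open>i\<close>-th landmark. The landmark manifold is open in this vector space, which
  therefore also serves as each of its tangent spaces.\<close>

definition landmark_manifold :: "(real ^ 'd ^ 'n) set" where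
  "landmark_manifold = {x. \<forall>i j. i \<noteq> j \<longrightarrow> x $ i \<noteq> x $ j}"

definition landmark_lift :: "(real ^ 'd \<Rightarrow> real ^ 'd) \<Rightarrow> real ^ 'd ^ 'n \<Rightarrow> real ^ 'd ^ 'n" where
  "landmark_lift X x = (\<chi> i. X (x $ i))"

definition X\<^sub>0\<^sub>0 :: "real ^ 2 \<Rightarrow> real ^ 2" where
  "X\<^sub>0\<^sub>0 p = vector [1, 0]"

definition X\<^sub>1\<^sub>3 :: "real ^ 2 \<Rightarrow> real ^ 2" where
  "X\<^sub>1\<^sub>3 p = (let x = p $ 1; y = p $ 2 in
     vector [- y * (3 * x\<^sup>2 - y\<^sup>2), x * (x\<^sup>2 - 3 * y\<^sup>2)])"

text \<open>Absolute continuity of a curve, as opposed to the library's \<^const>\<open>absolutely_continuous\<close> for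
  measures. The members \<open>K\<close> of \<open>\<D>\<close> are finitely many non-overlapping compact intervals
  \<open>[Inf K, Sup K]\<close>, whose union \<open>T\<close> need not be all of \<open>S\<close>.\<close>

definition absolutely_continuous_curve_on :: "real set \<Rightarrow> (real \<Rightarrow> 'a::real_normed_vector) \<Rightarrow> bool" where
  "absolutely_continuous_curve_on S \<gamma> \<longleftrightarrow>
     (\<forall>\<epsilon>>0. \<exists>\<delta>>0. \<forall>\<D> T. \<D> division_of T \<and> T \<subseteq> S \<and> (\<Sum>K\<in>\<D>. Sup K - Inf K) < \<delta> \<longrightarrow>
        (\<Sum>K\<in>\<D>. norm (\<gamma> (Sup K) - \<gamma> (Inf K))) < \<epsilon>)"

text \<open>Below, \<open>M\<close> is an open subset of a Euclidean space and \<open>E x\<close> is the fibre at \<open>x\<close> of a family of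
  subspaces of its tangent spaces. Only the values of curves on \<open>[0,1]\<close> matter.\<close>

definition horizontal_curve ::
    "'a::euclidean_space set \<Rightarrow> ('a \<Rightarrow> 'a set) \<Rightarrow> (real \<Rightarrow> 'a) \<Rightarrow> bool" where
  "horizontal_curve M E \<gamma> \<longleftrightarrow>
     \<gamma> ` {0..1} \<subseteq> M \<and>
     absolutely_continuous_curve_on {0..1} \<gamma> \<and>
     (AE t in lebesgue_on {0..1}.
        \<exists>v \<in> E (\<gamma> t). (\<gamma> has_vector_derivative v) (at t within {0..1}))"

definition orbit_of ::
    "'a::euclidean_space set \<Rightarrow> ('a \<Rightarrow> 'a set) \<Rightarrow> 'a \<Rightarrow> 'a set" where
  "orbit_of M E q = {p. \<exists>\<gamma>. horizontal_curve M E \<gamma> \<and> \<gamma> 0 = q \<and> \<gamma> 1 = p}"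

definition completely_controllable ::
    "'a::euclidean_space set \<Rightarrow> ('a \<Rightarrow> 'a set) \<Rightarrow> bool" where
  "completely_controllable M E \<longleftrightarrow> (\<forall>q\<in>M. orbit_of M E q = M)"

end

theory Submission
  imports Defs "HOL-Computational_Algebra.Polynomial"
begin

text \<open>Identify \<open>\<real>\<^sup>2\<close> with \<open>\<complex>\<close>. Then \<open>X\<^sub>0\<^sub>0 = 1\<close> and \<open>X\<^sub>1\<^sub>3 = \<i> z\<^sup>3\<close>, with flows \<open>z + t\<close> and
  \<open>\<psi>\<^sub>t z = z / csqrt w\<close>, where \<open>w = 1 - 2 \<i> t z\<^sup>2\<close>. Conjugating one flow by compositions of the others gives
  further directions in which the landmarks can be steered. Conjugating \<open>X\<^sub>1\<^sub>3\<close> by translations yields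
  \<open>\<i> (z + s)\<^sup>3\<close> for all real \<open>s\<close>, hence the constant \<open>\<i>\<close>; conjugating the constants \<open>1\<close> and \<open>\<i>\<close> by
  \<open>\<psi>\<^sub>t\<close> multiplies them by \<open>csqrt w ^ 3\<close>. A covector \<open>\<mu>\<close> annihilating all these directions satisfies
  \<open>\<Sum>\<^sub>i \<mu>\<^sub>i (1 - \<i> t a\<^sub>i) powr (3/2) = 0\<close> for small \<open>t\<close>, where \<open>a\<^sub>i = 2 (z\<^sub>i + s)\<^sup>2\<close> are distinct for
  suitable \<open>s\<close>. Differentiating in \<open>t\<close> at \<open>0\<close> gives \<open>\<Sum>\<^sub>i \<mu>\<^sub>i a\<^sub>i ^ k = 0\<close> for every \<open>k\<close>, so \<open>\<mu> = 0\<close>.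
  Thus every orbit is open, and the configuration space is connected because the complex line
  through two configurations meets the diagonals in finitely many points only.\<close>

section \<open>Curves with finitely many corners\<close>

text \<open>Lipschitz curves that are differentiable off a finite set are closed under reversal and
  concatenation and are absolutely continuous. Asking for derivatives only at interior parameters
  makes gluing easy.\<close>

definition steers :: "'a::euclidean_space set \<Rightarrow> ('a \<Rightarrow> 'a set) \<Rightarrow> 'a \<Rightarrow> 'a \<Rightarrow> bool" where
  "steers M E p q \<longleftrightarrow>
     (\<exists>\<gamma> F L. finite F \<and> L-lipschitz_on {0..1} \<gamma> \<and> \<gamma> ` {0..1} \<subseteq> M \<and> \<gamma> 0 = p \<and> \<gamma> 1 = q \<and>
        (\<forall>t\<in>{0<..<1} - F. \<exists>v\<in>E (\<gamma> t). (\<gamma> has_vector_derivative v) (at t)))"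

lemma steersE:
  assumes "steers M E p q"
  obtains \<gamma> F L where "finite F" "L-lipschitz_on {0..1} \<gamma>" "\<gamma> ` {0..1} \<subseteq> M" "\<gamma> 0 = p" "\<gamma> 1 = q"
    "\<And>t. t \<in> {0<..<1} - F \<Longrightarrow> \<exists>v\<in>E (\<gamma> t). (\<gamma> has_vector_derivative v) (at t)"
  using assms unfolding steers_def by blast

lemma steers_C1:
  fixes \<gamma> :: "real \<Rightarrow> 'a::euclidean_space"
  assumes der: "\<And>t. t \<in> {0..1} \<Longrightarrow> (\<gamma> has_vector_derivative \<gamma>' t) (at t)"
    and cont: "continuous_on {0..1} \<gamma>'"
    and M: "\<And>t. t \<in> {0..1} \<Longrightarrow> \<gamma> t \<in> M" and E: "\<And>t. t \<in> {0..1} \<Longrightarrow> \<gamma>' t \<in> E (\<gamma> t)"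
  shows "steers M E (\<gamma> 0) (\<gamma> 1)"
proof -
  have "bounded (\<gamma>' ` {0..1})"
    using cont compact_continuous_image compact_imp_bounded by blast
  then obtain C where C: "\<And>t. t \<in> {0..1} \<Longrightarrow> norm (\<gamma>' t) \<le> C"
    unfolding bounded_iff by blast
  have "C-lipschitz_on {0..1} \<gamma>"
  proof (rule bounded_derivative_imp_lipschitz[where f' = "\<lambda>t h. h *\<^sub>R \<gamma>' t"])
    fix t :: real assume t: "t \<in> {0..1}"
    show "(\<gamma> has_derivative (\<lambda>h. h *\<^sub>R \<gamma>' t)) (at t within {0..1})"
      using der[OF t] has_derivative_at_withinI unfolding has_vector_derivative_def by blast
    show "onorm (\<lambda>h. h *\<^sub>R \<gamma>' t) \<le> C"
      using C[OF t] by (simp add: onorm_scaleR_left onorm_id)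
  next
    show "0 \<le> C" using order_trans[OF norm_ge_zero C[of 0]] by simp
  qed simp
  moreover have "\<exists>v\<in>E (\<gamma> t). (\<gamma> has_vector_derivative v) (at t)" if "t \<in> {0<..<1} - {}" for t
    using that der[of t] E[of t] by auto
  moreover have "\<gamma> ` {0..1} \<subseteq> M" using M by blast
  ultimately show ?thesis
    unfolding steers_def by blast
qed

lemma lipschitz_imp_absolutely_continuous_curve_on:
  assumes "L-lipschitz_on S \<gamma>"
  shows "absolutely_continuous_curve_on S \<gamma>"
  unfolding absolutely_continuous_curve_on_def
proof (intro allI impI)
  fix e :: real assume e: "e > 0"
  have L: "L \<ge> 0" using assms lipschitz_on_nonneg by blast
  show "\<exists>d>0. \<forall>\<D> T. \<D> division_of T \<and> T \<subseteq> S \<and> (\<Sum>K\<in>\<D>. Sup K - Inf K) < d \<longrightarrow>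
        (\<Sum>K\<in>\<D>. norm (\<gamma> (Sup K) - \<gamma> (Inf K))) < e"
  \<comment> \<open>Dividing by \<open>L + 1\<close> instead of \<open>L\<close> covers constant
    curves with \<open>L = 0\<close>.\<close>
  proof (intro exI[of _ "e / (L + 1)"] conjI allI impI)
    show "0 < e / (L + 1)" using e L by simp
    fix \<D> T assume D: "\<D> division_of T \<and> T \<subseteq> S \<and> (\<Sum>K\<in>\<D>. Sup K - Inf K) < e / (L + 1)"
    have le: "norm (\<gamma> (Sup K) - \<gamma> (Inf K)) \<le> L * (Sup K - Inf K) \<and> 0 \<le> Sup K - Inf K"
      if K: "K \<in> \<D>" for K
    proof -
      obtain a b where ab: "K = {a..b}" "K \<noteq> {}" "K \<subseteq> T"
        using D K division_ofD[of \<D> T] by (metis box_real(2))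
      then have "a \<le> b" "Sup K = b" "Inf K = a" by auto
      moreover have "a \<in> S" "b \<in> S" using ab D \<open>a \<le> b\<close> by auto
      ultimately show ?thesis
        using lipschitz_onD[OF assms, of b a] by (simp add: dist_norm)
    qed
    have "(\<Sum>K\<in>\<D>. norm (\<gamma> (Sup K) - \<gamma> (Inf K))) \<le> L * (\<Sum>K\<in>\<D>. Sup K - Inf K)"
      unfolding sum_distrib_left using le by (intro sum_mono) auto
    also have "\<dots> \<le> (L + 1) * (\<Sum>K\<in>\<D>. Sup K - Inf K)"
      using le by (intro mult_right_mono sum_nonneg) auto
    also have "\<dots> < e" using D L by (simp add: field_simps)
    finally show "(\<Sum>K\<in>\<D>. norm (\<gamma> (Sup K) - \<gamma> (Inf K))) < e" .
  qed
qed

text \<open>The corners together with the two endpoints form a finite, hence negligible, set;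
  everywhere else the two-sided derivative restricts to the one within
  \<open>{0..1}\<close>.\<close>

lemma steers_imp_orbit:
  assumes "steers M E p q"
  shows "q \<in> orbit_of M E p"
proof -
  obtain \<gamma> F L where g: "finite F" "L-lipschitz_on {0..1} \<gamma>" "\<gamma> ` {0..1} \<subseteq> M" "\<gamma> 0 = p" "\<gamma> 1 = q"
    and d: "\<And>t. t \<in> {0<..<1} - F \<Longrightarrow> \<exists>v\<in>E (\<gamma> t). (\<gamma> has_vector_derivative v) (at t)"
    using assms by (elim steersE) blast
  have "AE t in lebesgue_on {0..1}. \<exists>v\<in>E (\<gamma> t). (\<gamma> has_vector_derivative v) (at t within {0..1})"
  proof -
    have n: "negligible (F \<union> {0,1})" using g(1) by (intro negligible_finite) auto
    have "AE t in lebesgue. t \<notin> F \<union> {0,1}"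
      using n AE_not_in negligible_iff_null_sets by blast
    then have "AE t in lebesgue. t \<in> {0..1} \<longrightarrow>
        (\<exists>v\<in>E (\<gamma> t). (\<gamma> has_vector_derivative v) (at t within {0..1}))"
    proof (rule AE_mp, intro AE_I2 impI)
      fix t :: real assume "t \<notin> F \<union> {0,1}" "t \<in> {0..1}"
      then have "t \<in> {0<..<1} - F" by auto
      from d[OF this] show "\<exists>v\<in>E (\<gamma> t). (\<gamma> has_vector_derivative v) (at t within {0..1})"
        using has_vector_derivative_at_within by blast
    qed
    then show ?thesis by (subst AE_restrict_space_iff) auto
  qed
  then show ?thesis
    unfolding orbit_of_def horizontal_curve_def
    using g lipschitz_imp_absolutely_continuous_curve_on by blast
qed

text \<open>Running a curve backwards negates its velocity, which stays in the subspace
  \<open>E x\<close>.\<close>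

lemma steers_sym:
  assumes E: "\<And>x. subspace (E x)" and "steers M E p q"
  shows "steers M E q p"
proof -
  obtain \<gamma> F L where g: "finite F" "L-lipschitz_on {0..1} \<gamma>" "\<gamma> ` {0..1} \<subseteq> M" "\<gamma> 0 = p" "\<gamma> 1 = q"
    and d: "\<And>t. t \<in> {0<..<1} - F \<Longrightarrow> \<exists>v\<in>E (\<gamma> t). (\<gamma> has_vector_derivative v) (at t)"
    using assms(2) by (elim steersE) blast
  let ?g = "\<lambda>t. \<gamma> (1 - t)"
  have "(1 * L)-lipschitz_on {0..1} ?g"
  proof (rule lipschitz_onI)
    fix x y :: real assume "x \<in> {0..1}" "y \<in> {0..1}"
    then show "dist (?g x) (?g y) \<le> 1 * L * dist x y"
      using lipschitz_onD[OF g(2), of "1 - x" "1 - y"] by (auto simp: dist_real_def abs_minus_commute)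
  qed (use lipschitz_on_nonneg[OF g(2)] in simp)
  moreover have "\<exists>v\<in>E (?g t). (?g has_vector_derivative v) (at t)"
    if "t \<in> {0<..<1} - (\<lambda>s. 1 - s) ` F" for t
  proof -
    have "1 - t \<in> {0<..<1} - F" using that by force
    from d[OF this] obtain v where v: "v \<in> E (\<gamma> (1 - t))"
      "(\<gamma> has_vector_derivative v) (at (1 - t))" by blast
    have "((\<lambda>t. 1 - t) has_vector_derivative -1) (at t)"
      by (auto intro!: derivative_eq_intros)
    from vector_diff_chain_at[OF this v(2)]
    have "(?g has_vector_derivative (-1) *\<^sub>R v) (at t)" by (simp add: o_def)
    moreover have "(-1) *\<^sub>R v \<in> E (?g t)" using v(1) E subspace_scale by blast
    ultimately show ?thesis by blast
  qed
  moreover have "?g ` {0..1} \<subseteq> M" using g(3) by auto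
  ultimately show ?thesis unfolding steers_def using g
    by (intro exI[of _ ?g] exI[of _ "(\<lambda>s. 1 - s) ` F"] exI[of _ "1 * L"]) auto
qed

text \<open>Both curves are run at double speed, so velocities are doubled and stay in the fibres.
  The joint \<open>1/2\<close> and the rescaled corners become the new exceptional set.\<close>

lemma steers_trans:
  assumes E: "\<And>x. subspace (E x)" and "steers M E p q" "steers M E q r"
  shows "steers M E p r"
proof -
  obtain \<gamma> F L where g: "finite F" "L-lipschitz_on {0..1} \<gamma>" "\<gamma> ` {0..1} \<subseteq> M" "\<gamma> 0 = p" "\<gamma> 1 = q"
    and d: "\<And>t. t \<in> {0<..<1} - F \<Longrightarrow> \<exists>v\<in>E (\<gamma> t). (\<gamma> has_vector_derivative v) (at t)"
    using assms(2) by (elim steersE) blast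
  obtain \<delta> F' L' where g': "finite F'" "L'-lipschitz_on {0..1} \<delta>" "\<delta> ` {0..1} \<subseteq> M" "\<delta> 0 = q" "\<delta> 1 = r"
    and d': "\<And>t. t \<in> {0<..<1} - F' \<Longrightarrow> \<exists>v\<in>E (\<delta> t). (\<delta> has_vector_derivative v) (at t)"
    using assms(3) by (elim steersE) blast
  let ?l = "\<lambda>t. \<gamma> (2 * t)" and ?r = "\<lambda>t. \<delta> (2 * t - 1)"
  let ?j = "\<lambda>t. if t \<le> 1/2 then ?l t else ?r t"
  let ?K = "2 * max L L'"
  let ?F = "{1/2} \<union> (\<lambda>s. s / 2) ` F \<union> (\<lambda>s. (s + 1) / 2) ` F'"
  have nn: "0 \<le> L" "0 \<le> L'" using g(2) g'(2) lipschitz_on_nonneg by auto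
  have "?K-lipschitz_on {0..1/2} ?l"
  proof (rule lipschitz_onI)
    fix x y :: real assume "x \<in> {0..1/2}" "y \<in> {0..1/2}"
    then have "dist (?l x) (?l y) \<le> L * dist (2 * x) (2 * y)"
      by (intro lipschitz_onD[OF g(2)]) auto
    also have "\<dots> = 2 * (L * dist x y)" by (auto simp: dist_real_def abs_if)
    also have "\<dots> \<le> ?K * dist x y" by (simp add: mult_right_mono)
    finally show "dist (?l x) (?l y) \<le> ?K * dist x y" .
  qed (use nn in simp)
  moreover have "?K-lipschitz_on {1/2..1} ?r"
  proof (rule lipschitz_onI)
    fix x y :: real assume "x \<in> {1/2..1}" "y \<in> {1/2..1}"
    then have "dist (?r x) (?r y) \<le> L' * dist (2 * x - 1) (2 * y - 1)"
      by (intro lipschitz_onD[OF g'(2)]) auto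
    also have "\<dots> = 2 * (L' * dist x y)" by (auto simp: dist_real_def abs_if)
    also have "\<dots> \<le> ?K * dist x y" by (simp add: mult_right_mono)
    finally show "dist (?r x) (?r y) \<le> ?K * dist x y" .
  qed (use nn in simp)
  ultimately have lip: "?K-lipschitz_on {0..1} ?j"
    using lipschitz_on_concat[of ?K 0 "1/2" ?l 1 ?r] g(5) g'(4) by simp
  have "\<exists>v\<in>E (?j t). (?j has_vector_derivative v) (at t)" if t: "t \<in> {0<..<1} - ?F" for t
  proof (cases "t < 1/2")
    case True
    have "2 * t \<notin> F" using t image_eqI[of t "\<lambda>s. s / 2" "2 * t" F] by auto
    then have "2 * t \<in> {0<..<1} - F" using t True by simp
    from d[OF this] obtain v where v: "v \<in> E (\<gamma> (2 * t))" "(\<gamma> has_vector_derivative v) (at (2 * t))"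
      by blast
    have "((\<lambda>t. 2 * t) has_vector_derivative 2) (at t)"
      by (auto intro!: derivative_eq_intros)
    from vector_diff_chain_at[OF this v(2)]
    have "(?l has_vector_derivative 2 *\<^sub>R v) (at t)" by (simp add: o_def)
    then have "(?j has_vector_derivative 2 *\<^sub>R v) (at t)"
      using True by (elim has_vector_derivative_transform_within_open[where S = "{..<1/2}"]) auto
    moreover have "2 *\<^sub>R v \<in> E (?j t)" using v(1) True E subspace_scale by auto
    ultimately show ?thesis by blast
  next
    case False
    then have t2: "t > 1/2" using t by auto
    have "2 * t - 1 \<notin> F'" using t image_eqI[of t "\<lambda>s. (s + 1) / 2" "2 * t - 1" F'] by auto
    then have "2 * t - 1 \<in> {0<..<1} - F'" using t t2 by simp
    from d'[OF this] obtain v where v: "v \<in> E (\<delta> (2 * t - 1))"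
      "(\<delta> has_vector_derivative v) (at (2 * t - 1))" by blast
    have "((\<lambda>t. 2 * t - 1) has_vector_derivative 2) (at t)"
      by (auto intro!: derivative_eq_intros)
    from vector_diff_chain_at[OF this v(2)]
    have "(?r has_vector_derivative 2 *\<^sub>R v) (at t)" by (simp add: o_def)
    then have "(?j has_vector_derivative 2 *\<^sub>R v) (at t)"
      using t2 by (elim has_vector_derivative_transform_within_open[where S = "{1/2<..}"]) auto
    moreover have "2 *\<^sub>R v \<in> E (?j t)" using v(1) t2 E subspace_scale by auto
    ultimately show ?thesis by blast
  qed
  moreover have "?j ` {0..1} \<subseteq> M" using g(3) g'(3) by (auto simp: image_subset_iff)
  moreover have "?j 0 = p" "?j 1 = r" using g g' by auto
  moreover have "finite ?F" using g(1) g'(1) by auto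
  ultimately show ?thesis unfolding steers_def using lip
    by (intro exI[of _ ?j] exI[of _ ?F] exI[of _ ?K]) blast
qed

text \<open>Carries steering from complex coordinates back to configurations in the real
  plane.\<close>

lemma steers_linear_image:
  fixes S :: "'a::euclidean_space \<Rightarrow> 'b::euclidean_space"
  assumes S: "linear S" "S ` M \<subseteq> M'" "\<And>x. S ` E x \<subseteq> E' (S x)" and "steers M E p q"
  shows "steers M' E' (S p) (S q)"
proof -
  obtain \<gamma> F L where g: "finite F" "L-lipschitz_on {0..1} \<gamma>" "\<gamma> ` {0..1} \<subseteq> M" "\<gamma> 0 = p" "\<gamma> 1 = q"
    and d: "\<And>t. t \<in> {0<..<1} - F \<Longrightarrow> \<exists>v\<in>E (\<gamma> t). (\<gamma> has_vector_derivative v) (at t)"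
    using assms(4) by (elim steersE) blast
  have bl: "bounded_linear S" using S(1) linear_conv_bounded_linear by blast
  obtain B where B: "B > 0" "\<And>x. norm (S x) \<le> norm x * B"
    using bounded_linear.pos_bounded[OF bl] by blast
  have "B-lipschitz_on UNIV S"
    using B by (intro lipschitz_onI) (auto simp: dist_norm mult.commute simp flip: linear_diff[OF S(1)])
  then have "(B * L)-lipschitz_on {0..1} (\<lambda>t. S (\<gamma> t))"
    using g(2) lipschitz_on_compose2 lipschitz_on_subset by blast
  moreover have "\<exists>v\<in>E' (S (\<gamma> t)). ((\<lambda>t. S (\<gamma> t)) has_vector_derivative v) (at t)"
    if "t \<in> {0<..<1} - F" for t
    using d[OF that] bounded_linear.has_vector_derivative[OF bl] S(3) by blast
  ultimately show ?thesis unfolding steers_def using g S(2)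
    by (intro exI[of _ "\<lambda>t. S (\<gamma> t)"] exI[of _ F] exI[of _ "B * L"]) auto
qed

section \<open>Local steering and conjugation\<close>

text \<open>The map \<open>e\<close> is a continuous family of moves: \<open>p\<close> is steered to \<open>e (h, p)\<close>, which to first order
  is \<open>p + L h\<close>. Surjectivity of \<open>L\<close> therefore makes the reachable set a neighbourhood of \<open>q\<close>.\<close>

definition steerable :: "('a::euclidean_space \<Rightarrow> 'a \<Rightarrow> bool) \<Rightarrow> 'a \<Rightarrow> ('a \<Rightarrow> 'a) \<Rightarrow> bool" where
  "steerable R q L \<longleftrightarrow>
     (\<exists>e U. open U \<and> (0, q) \<in> U \<and> continuous_on U e \<and> e (0, q) = q \<and>
        (e has_derivative (\<lambda>w. snd w + L (fst w))) (at (0, q)) \<and> (\<forall>w\<in>U. R (snd w) (e w)))"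

lemma steerableE:
  assumes "steerable R q L"
  obtains e U where "open U" "(0, q) \<in> U" "continuous_on U e" "e (0, q) = q"
    "(e has_derivative (\<lambda>w. snd w + L (fst w))) (at (0, q))" "\<And>w. w \<in> U \<Longrightarrow> R (snd w) (e w)"
  using assms unfolding steerable_def by blast

text \<open>Both moves receive the same parameter \<open>h\<close>: \<open>f\<close> acts first and
  \<open>e\<close> continues from its endpoint. By the chain rule the first-order displacements add
  up.\<close>

lemma steerable_add:
  assumes R: "transp R" and "steerable R q L" "steerable R q K"
  shows "steerable R q (\<lambda>h. L h + K h)"
proof -
  obtain e U where e: "open U" "(0, q) \<in> U" "continuous_on U e" "e (0, q) = q"
    "(e has_derivative (\<lambda>w. snd w + L (fst w))) (at (0, q))" "\<And>w. w \<in> U \<Longrightarrow> R (snd w) (e w)"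
    using assms(2) by (elim steerableE) blast
  obtain f V where f: "open V" "(0, q) \<in> V" "continuous_on V f" "f (0, q) = q"
    "(f has_derivative (\<lambda>w. snd w + K (fst w))) (at (0, q))" "\<And>w. w \<in> V \<Longrightarrow> R (snd w) (f w)"
    using assms(3) by (elim steerableE) blast
  let ?f = "\<lambda>w. (fst w, f w)"
  let ?W = "V \<inter> ?f -` U"
  have c: "continuous_on V ?f" using f(3) by (intro continuous_intros)
  have "open ?W" using continuous_open_preimage[OF c f(1) e(1)] .
  moreover have "(0, q) \<in> ?W" using e(2) f by simp
  moreover have "continuous_on ?W (\<lambda>w. e (?f w))"
    by (rule continuous_on_compose2[OF e(3)]) (auto intro: continuous_on_subset[OF c])
  moreover have "((\<lambda>w. e (?f w)) has_derivative (\<lambda>w. snd w + (L (fst w) + K (fst w)))) (at (0, q))"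
  proof -
    have "(?f has_derivative (\<lambda>w. (fst w, snd w + K (fst w)))) (at (0, q))"
      by (rule has_derivative_Pair[OF has_derivative_fst[OF has_derivative_ident] f(5)])
    from has_derivative_compose[OF this, of e "\<lambda>w. snd w + L (fst w)"] show ?thesis
      using e(5) f(4) by (simp add: algebra_simps)
  qed
  moreover have "R (snd w) (e (?f w))" if "w \<in> ?W" for w
    using that f(6)[of w] e(6)[of "?f w"] R by (auto elim: transpE)
  ultimately show ?thesis
    unfolding steerable_def using e(4) f(4)
    by (intro exI[of _ "\<lambda>w. e (?f w)"] exI[of _ ?W]) auto
qed

text \<open>Conjugation: go from \<open>p\<close> to \<open>\<Phi> p\<close>, move there, and return
  by \<open>\<Psi>\<close>. The displacement \<open>L h\<close> made near \<open>\<Phi> q\<close> is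
  seen at \<open>q\<close> through the differential of \<open>\<Psi>\<close>. The two maps need to
  be mutually inverse only at \<open>q\<close> and to first order.\<close>

lemma steerable_pullback:
  assumes R: "transp R" and L: "steerable R (\<Phi> q) L"
    and V: "open V" "q \<in> V" "continuous_on V \<Phi>" "\<And>p. p \<in> V \<Longrightarrow> R p (\<Phi> p)"
    and W: "open W" "\<Phi> q \<in> W" "continuous_on W \<Psi>" "\<And>p. p \<in> W \<Longrightarrow> R p (\<Psi> p)"
    and d\<Phi>: "(\<Phi> has_derivative \<Phi>') (at q)" and d\<Psi>: "(\<Psi> has_derivative \<Psi>') (at (\<Phi> q))"
    and inv: "\<Psi> (\<Phi> q) = q" "\<And>v. \<Psi>' (\<Phi>' v) = v"
  shows "steerable R q (\<lambda>h. \<Psi>' (L h))"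
proof -
  obtain e U where e: "open U" "(0, \<Phi> q) \<in> U" "continuous_on U e" "e (0, \<Phi> q) = \<Phi> q"
    "(e has_derivative (\<lambda>w. snd w + L (fst w))) (at (0, \<Phi> q))" "\<And>w. w \<in> U \<Longrightarrow> R (snd w) (e w)"
    using L by (elim steerableE) blast
  let ?f = "\<lambda>w. (fst w, \<Phi> (snd w))"
  let ?V = "(UNIV \<times> V) \<inter> ?f -` U"
  let ?W = "?V \<inter> (\<lambda>w. e (?f w)) -` W"
  have c: "continuous_on (UNIV \<times> V) ?f"
    by (intro continuous_intros continuous_on_compose2[OF V(3)]) auto
  have oV: "open ?V"
    using continuous_open_preimage[OF c _ e(1)] V(1) open_Times open_UNIV by blast
  have ce: "continuous_on ?V (\<lambda>w. e (?f w))"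
    by (rule continuous_on_compose2[OF e(3)]) (auto intro: continuous_on_subset[OF c])
  have "open ?W" using continuous_open_preimage[OF ce oV W(1)] .
  moreover have "(0, q) \<in> ?W" using e V W by simp
  moreover have "continuous_on ?W (\<lambda>w. \<Psi> (e (?f w)))"
    by (rule continuous_on_compose2[OF W(3)]) (auto intro: continuous_on_subset[OF ce])
  moreover have "((\<lambda>w. \<Psi> (e (?f w))) has_derivative (\<lambda>w. snd w + \<Psi>' (L (fst w)))) (at (0, q))"
  proof -
    have "((\<lambda>w. \<Phi> (snd w)) has_derivative (\<lambda>w. \<Phi>' (snd w))) (at (0, q))"
      using has_derivative_compose[OF has_derivative_snd[OF has_derivative_ident], of \<Phi> \<Phi>' "(0, q)"] d\<Phi>
      by simp
    then have "(?f has_derivative (\<lambda>w. (fst w, \<Phi>' (snd w)))) (at (0, q))"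
      by (rule has_derivative_Pair[OF has_derivative_fst[OF has_derivative_ident]])
    from has_derivative_compose[OF this, of e "\<lambda>w. snd w + L (fst w)"]
    have "((\<lambda>w. e (?f w)) has_derivative (\<lambda>w. \<Phi>' (snd w) + L (fst w))) (at (0, q))"
      using e(5) by simp
    from has_derivative_compose[OF this, of \<Psi> \<Psi>'] show ?thesis
      using d\<Psi> e(4) inv(2) linear_add[OF has_derivative_linear[OF d\<Psi>]] by simp
  qed
  moreover have "R (snd w) (\<Psi> (e (?f w)))" if "w \<in> ?W" for w
    using that transpD[OF R V(4)[of "snd w"] transpD[OF R _ W(4)[of "e (?f w)"]]] e(6)[of "?f w"]
    by (simp add: mem_Times_iff)
  ultimately show ?thesis
    unfolding steerable_def using e(4) inv(1)
    by (intro exI[of _ "\<lambda>w. \<Psi> (e (?f w))"] exI[of _ ?W]) auto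
qed

text \<open>The map \<open>h \<mapsto> e (h, q)\<close> is continuous, with derivative the identity
  at \<open>0\<close>. Differentiability is known at that point alone, so the topological open
  mapping theorem takes the place of the inverse function theorem.\<close>

lemma steerable_id_imp_interior:
  assumes "steerable R q (\<lambda>h. h)"
  shows "q \<in> interior {p. R q p}"
proof -
  obtain e U where e: "open U" "(0, q) \<in> U" "continuous_on U e" "e (0, q) = q"
    "(e has_derivative (\<lambda>w. snd w + fst w)) (at (0, q))" "\<And>w. w \<in> U \<Longrightarrow> R (snd w) (e w)"
    using assms by (elim steerableE) blast
  let ?g = "\<lambda>h. (h, q)"
  let ?S = "?g -` U"
  have c: "continuous_on UNIV ?g" by (intro continuous_intros)
  have S: "open ?S" using continuous_open_preimage[OF c open_UNIV e(1)] by simp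
  have "e (?g 0) \<in> interior ((\<lambda>h. e (?g h)) ` ?S)"
  proof (rule sussmann_open_mapping[OF S, where f' = "\<lambda>h. h" and g' = "\<lambda>h. h"])
    show "continuous_on ?S (\<lambda>h. e (?g h))"
      by (rule continuous_on_compose2[OF e(3)]) (auto intro: continuous_on_subset[OF c])
    have "(?g has_derivative (\<lambda>h. (h, 0))) (at 0)"
      by (intro has_derivative_Pair has_derivative_ident has_derivative_const)
    from has_derivative_compose[OF this, of e "\<lambda>w. snd w + fst w"]
    show "((\<lambda>h. e (?g h)) has_derivative (\<lambda>h. h)) (at 0)" using e(5) by simp
    show "0 \<in> interior ?S" using S e(2) by (simp add: interior_open)
  qed (use e(2) in \<open>auto simp: fun_eq_iff\<close>)
  moreover have "(\<lambda>h. e (?g h)) ` ?S \<subseteq> {p. R q p}" using e(6) by force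
  ultimately show ?thesis using e(4) interior_mono by (metis subset_iff)
qed

section \<open>Directions of steering as rank-one moves\<close>

text \<open>The functional \<open>h \<bullet> b\<close> lets moves along different vectors share one
  parameter space, so that \<open>steerable_add\<close> can assemble rank-one maps into the
  identity.\<close>

definition directions :: "('a::euclidean_space \<Rightarrow> 'a \<Rightarrow> bool) \<Rightarrow> 'a \<Rightarrow> 'a set" where
  "directions R q = {v. \<forall>b. steerable R q (\<lambda>h. (h \<bullet> b) *\<^sub>R v)}"

lemma directions_scaleR: "v \<in> directions R q \<Longrightarrow> c *\<^sub>R v \<in> directions R q"
  unfolding directions_def
proof (intro CollectI allI)
  fix b assume "v \<in> {v. \<forall>b. steerable R q (\<lambda>h. (h \<bullet> b) *\<^sub>R v)}"
  then have "steerable R q (\<lambda>h. (h \<bullet> (c *\<^sub>R b)) *\<^sub>R v)" by blast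
  then show "steerable R q (\<lambda>h. (h \<bullet> b) *\<^sub>R c *\<^sub>R v)" by (simp add: mult.commute)
qed

lemma subspace_directions:
  assumes "transp R" "directions R q \<noteq> {}"
  shows "subspace (directions R q)"
proof -
  obtain v where "v \<in> directions R q" using assms(2) by blast
  from directions_scaleR[OF this, of 0] have "0 \<in> directions R q" by simp
  moreover have "u + v \<in> directions R q" if "u \<in> directions R q" "v \<in> directions R q" for u v
    using that steerable_add[OF assms(1)] unfolding directions_def by (simp add: scaleR_add_right)
  ultimately show ?thesis unfolding subspace_def using directions_scaleR by blast
qed

text \<open>The basis expansion writes the identity as the sum of the rank-one maps
  \<open>(h \<bullet> b) *\<^sub>R b\<close>.\<close>

lemma directions_UNIV_imp_interior:
  assumes R: "transp R" and D: "directions R q = UNIV"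
  shows "q \<in> interior {p. R q p}"
proof -
  have s: "steerable R q (\<lambda>h. (h \<bullet> b) *\<^sub>R v)" for b v using D unfolding directions_def by blast
  have "steerable R q (\<lambda>h. \<Sum>b\<in>B. (h \<bullet> b) *\<^sub>R b)" if "finite B" for B
    using that
  proof (induction B rule: finite_induct)
    case empty
    show ?case using s[of 0 0] by simp
  next
    case (insert b B)
    then show ?case using steerable_add[OF R s[of b b] insert.IH] by simp
  qed
  from this[OF finite_Basis] show ?thesis
    by (intro steerable_id_imp_interior) (simp add: euclidean_representation)
qed

lemma directions_pullback:
  assumes "transp R" and "v \<in> directions R (\<Phi> q)"
    and "open V" "q \<in> V" "continuous_on V \<Phi>" "\<And>p. p \<in> V \<Longrightarrow> R p (\<Phi> p)"
    and "open W" "\<Phi> q \<in> W" "continuous_on W \<Psi>" "\<And>p. p \<in> W \<Longrightarrow> R p (\<Psi> p)"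
    and "(\<Phi> has_derivative \<Phi>') (at q)" and "(\<Psi> has_derivative \<Psi>') (at (\<Phi> q))"
    and "\<Psi> (\<Phi> q) = q" "\<And>v. \<Psi>' (\<Phi>' v) = v"
  shows "\<Psi>' v \<in> directions R q"
  unfolding directions_def
proof (intro CollectI allI)
  fix b
  have "steerable R (\<Phi> q) (\<lambda>h. (h \<bullet> b) *\<^sub>R v)" using assms(2) unfolding directions_def by blast
  from steerable_pullback[OF assms(1) this assms(3-)]
  show "steerable R q (\<lambda>h. (h \<bullet> b) *\<^sub>R \<Psi>' v)"
    using linear_scale[OF has_derivative_linear[OF assms(12)]] by simp
qed

text \<open>A family of moves with one real parameter suffices: substituting
  \<open>h \<bullet> b\<close> for the parameter gives the required rank-one map.\<close>

lemma directionsI: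
  assumes "open U" "(0, q) \<in> U" "continuous_on U e" "e (0, q) = q"
    and "(e has_derivative (\<lambda>w. snd w + fst w *\<^sub>R v)) (at (0, q))"
    and "\<And>s p. (s, p) \<in> U \<Longrightarrow> R p (e (s, p))"
  shows "v \<in> directions R q"
  unfolding directions_def
proof (intro CollectI allI)
  fix b :: 'a
  let ?f = "\<lambda>w :: 'a \<times> 'a. (fst w \<bullet> b, snd w)"
  have f: "bounded_linear ?f"
    by (intro bounded_linear_Pair bounded_linear_compose[OF bounded_linear_inner_left] bounded_linear_fst bounded_linear_snd)
  have c: "continuous_on UNIV ?f" using f by (rule linear_continuous_on)
  have "open (?f -` U)" using continuous_open_preimage[OF c open_UNIV assms(1)] by simp
  moreover have "(0, q) \<in> ?f -` U" using assms(2) by simp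
  moreover have "continuous_on (?f -` U) (\<lambda>w. e (?f w))"
    by (rule continuous_on_compose2[OF assms(3)]) (auto intro: continuous_on_subset[OF c])
  moreover have "((\<lambda>w. e (?f w)) has_derivative (\<lambda>w. snd w + (fst w \<bullet> b) *\<^sub>R v)) (at (0, q))"
    using has_derivative_compose[OF bounded_linear_imp_has_derivative[OF f], of e "\<lambda>w. snd w + fst w *\<^sub>R v"] assms(5)
    by simp
  moreover have "R (snd w) (e (?f w))" if "w \<in> ?f -` U" for w
    using that assms(6) by simp
  ultimately show "steerable R q (\<lambda>h. (h \<bullet> b) *\<^sub>R v)"
    unfolding steerable_def using assms(4)
    by (intro exI[of _ "\<lambda>w. e (?f w)"] exI[of _ "?f -` U"]) auto
qed

section \<open>The flow of the cubic field on configurations\<close>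

definition cubic_disc :: "real \<Rightarrow> complex \<Rightarrow> complex" where
  "cubic_disc t z = 1 - 2 * \<i> * of_real t * z\<^sup>2"

text \<open>Along solutions of \<open>z' = \<i> z^3\<close> the quantity \<open>1 / z^2\<close> has
  constant derivative \<open>-2 \<i>\<close>. Hence \<open>1 / z^2\<close> gets multiplied by
  \<open>cubic_disc t z\<close>, and taking a root gives this formula.\<close>

definition cubic_flow :: "real \<Rightarrow> complex \<Rightarrow> complex" where
  "cubic_flow t z = z / csqrt (cubic_disc t z)"

lemma cubic_disc_0 [simp]: "cubic_disc 0 z = 1"
  and cubic_flow_0 [simp]: "cubic_flow 0 z = z"
  by (simp_all add: cubic_disc_def cubic_flow_def)

lemma Re_pos_imp_not_nonpos_Reals: "Re w > 0 \<Longrightarrow> w \<notin> \<real>\<^sub>\<le>\<^sub>0"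
  by (auto simp: complex_nonpos_Reals_iff)

lemma Re_inverse_pos: "Re w > 0 \<Longrightarrow> Re (inverse w) > 0"
  by (auto intro!: divide_pos_pos add_pos_nonneg)

text \<open>The inverse of a number with positive real part has positive real part, so it is again
  the principal root. On the branch cut this fails, for instance at \<open>w = -1\<close>.\<close>

lemma csqrt_inverse_Re_pos:
  assumes "Re w > 0"
  shows "csqrt (inverse w) = inverse (csqrt w)"
proof (rule csqrt_unique)
  show "(inverse (csqrt w))\<^sup>2 = inverse w" by (simp add: power_inverse)
  have "Re (csqrt w) > 0" using assms by (simp add: add_nonneg_pos)
  from Re_inverse_pos[OF this]
  show "0 < Re (inverse (csqrt w)) \<or> Re (inverse (csqrt w)) = 0 \<and> 0 \<le> Im (inverse (csqrt w))"
    by blast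
qed

text \<open>With \<open>w = cubic_disc t z\<close> the left side is
  \<open>1 + 2 \<i> t z^2 / w\<close>, whose numerator over \<open>w\<close> is
  \<open>w + 2 \<i> t z^2 = 1\<close>.\<close>

lemma cubic_disc_flow:
  assumes "Re (cubic_disc t z) > 0"
  shows "cubic_disc (-t) (cubic_flow t z) = inverse (cubic_disc t z)"
proof -
  have "cubic_disc t z \<noteq> 0" using assms by auto
  moreover have "(csqrt (cubic_disc t z))\<^sup>2 = cubic_disc t z" by simp
  ultimately show ?thesis
    unfolding cubic_disc_def[of "-t"] cubic_flow_def power_divide
    by (simp add: field_simps) (simp add: cubic_disc_def)
qed

lemma cubic_flow_inverse:
  assumes "Re (cubic_disc t z) > 0"
  shows "cubic_flow (-t) (cubic_flow t z) = z"
proof -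
  have "cubic_disc t z \<noteq> 0" using assms by auto
  then show ?thesis
    using cubic_disc_flow[OF assms] csqrt_inverse_Re_pos[OF assms]
    by (simp add: cubic_flow_def[of "-t"]) (simp add: cubic_flow_def)
qed

lemma continuous_cubic_disc [continuous_intros]:
  assumes "continuous_on A f" "continuous_on A g"
  shows "continuous_on A (\<lambda>x. cubic_disc (f x) (g x))"
  unfolding cubic_disc_def by (intro continuous_intros assms)

lemma cubic_flow_has_derivative:
  assumes "Re (cubic_disc t z) > 0"
  shows "((\<lambda>w. cubic_flow (fst w) (snd w)) has_derivative
     (\<lambda>h. snd h / csqrt (cubic_disc t z) ^ 3 + fst h *\<^sub>R (\<i> * cubic_flow t z ^ 3))) (at (t, z))"
proof -
  let ?S = "csqrt (cubic_disc t z)"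
  have nz: "cubic_disc t z \<noteq> 0" using assms by auto
  have S2: "?S ^ 2 = 1 - 2 * \<i> * of_real t * z\<^sup>2" by (simp add: cubic_disc_def)
  let ?D = "\<lambda>h :: real \<times> complex. - 2 * \<i> * (of_real (fst h) * z\<^sup>2 + of_real t * (2 * z * snd h))"
  have "((\<lambda>w. cubic_disc (fst w) (snd w)) has_derivative ?D) (at (t, z))"
    unfolding cubic_disc_def
    by (rule derivative_eq_intros refl | simp add: fun_eq_iff algebra_simps)+
  moreover have "(csqrt has_derivative (*) (inverse (2 * ?S))) (at (cubic_disc t z))"
    using has_field_derivative_csqrt[OF Re_pos_imp_not_nonpos_Reals[OF assms]]
    unfolding has_field_derivative_def .
  ultimately have "((\<lambda>w. csqrt (cubic_disc (fst w) (snd w))) has_derivative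
      (\<lambda>h. inverse (2 * ?S) * ?D h)) (at (t, z))"
    using has_derivative_compose[of "\<lambda>w. cubic_disc (fst w) (snd w)" ?D "(t, z)" UNIV csqrt "(*) (inverse (2 * ?S))"] by simp
  from has_derivative_divide[OF has_derivative_snd[OF has_derivative_ident] this]
  have "((\<lambda>w. cubic_flow (fst w) (snd w)) has_derivative
     (\<lambda>h. - z * (inverse ?S * (inverse (2 * ?S) * ?D h) * inverse ?S) + snd h / ?S)) (at (t, z))"
    using nz unfolding cubic_flow_def by simp
  moreover have "- z * (inverse ?S * (inverse (2 * ?S) * ?D h) * inverse ?S) + snd h / ?S
     = snd h / ?S ^ 3 + fst h *\<^sub>R (\<i> * cubic_flow t z ^ 3)" for h
  proof -
    have "?S \<noteq> 0" using nz by simp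
    then have "- z * (inverse ?S * (inverse (2 * ?S) * ?D h) * inverse ?S) + snd h / ?S
        = (snd h * ?S ^ 2 - z * ?D h / 2) / ?S ^ 3"
      by (simp add: divide_simps power2_eq_square power3_eq_cube)
    \<comment> \<open>Inserting the value of \<open>?S ^ 2\<close> cancels the terms containing
      \<open>t\<close>, which leaves the spatial derivative \<open>1 / ?S ^ 3\<close>.\<close>
    also have "\<dots> = (snd h + \<i> * of_real (fst h) * z ^ 3) / ?S ^ 3"
      unfolding S2 by (simp add: field_simps power2_eq_square power3_eq_cube)
    finally show ?thesis
      unfolding cubic_flow_def scaleR_conv_of_real power_divide add_divide_distrib by simp
  qed
  ultimately show ?thesis by simp
qed

lemma has_derivative_vec_lambda:
  fixes f :: "'a::euclidean_space \<Rightarrow> 'n::finite \<Rightarrow> 'b::euclidean_space"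
  assumes "\<And>i. ((\<lambda>x. f x i) has_derivative (\<lambda>h. f' h i)) (at x)"
  shows "((\<lambda>x. \<chi> i. f x i) has_derivative (\<lambda>h. \<chi> i. f' h i)) (at x)"
proof -
  have l: "linear (\<lambda>h. f' h i)" for i using has_derivative_linear[OF assms] .
  have "linear (\<lambda>h. \<chi> i. f' h i)"
    by (rule linearI) (simp_all add: vec_eq_iff linear_add[OF l] linear_scale[OF l])
  then have "bounded_linear (\<lambda>h. \<chi> i. f' h i)" using linear_conv_bounded_linear by blast
  moreover have "((\<lambda>y. ((\<chi> i. f y i) - (\<chi> i. f x i) - (\<chi> i. f' (y - x) i)) /\<^sub>R norm (y - x)) \<longlongrightarrow> 0) (at x)"
    using assms unfolding has_derivative_at_within by (intro vec_tendstoI) simp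
  ultimately show ?thesis unfolding has_derivative_at_within by blast
qed

section \<open>Complex configurations and the lifted flow\<close>

definition distinct_points :: "(complex ^ 'n) set" where
  "distinct_points = {z. \<forall>i j. i \<noteq> j \<longrightarrow> z $ i \<noteq> z $ j}"

definition cubic_span :: "complex ^ 'n \<Rightarrow> (complex ^ 'n) set" where
  "cubic_span z = span {1, \<chi> i. \<i> * (z $ i) ^ 3}"

abbreviation reach :: "complex ^ 'n \<Rightarrow> complex ^ 'n \<Rightarrow> bool" where
  "reach \<equiv> steers distinct_points cubic_span"

text \<open>On this set the principal square root in \<^const>\<open>cubic_flow\<close> continues the solution from time \<open>0\<close>
  to time \<open>t\<close> without crossing the branch cut.\<close>

definition cubic_flow_dom :: "real \<Rightarrow> (complex ^ 'n) set" where
  "cubic_flow_dom t = {z \<in> distinct_points. \<forall>i. Re (cubic_disc t (z $ i)) > 0}"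

abbreviation lift_flow :: "real \<Rightarrow> complex ^ 'n \<Rightarrow> complex ^ 'n" where
  "lift_flow t z \<equiv> \<chi> i. cubic_flow t (z $ i)"

lemma subspace_cubic_span: "subspace (cubic_span z)"
  unfolding cubic_span_def by (rule subspace_span)

lemma transp_reach: "transp reach"
  using steers_trans[OF subspace_cubic_span] by (rule transpI)

lemma open_distinct_points: "open (distinct_points :: (complex ^ 'n) set)"
proof -
  have "distinct_points = (\<Inter>i. \<Inter>j\<in>- {i}. {z :: complex ^ 'n. z $ i \<noteq> z $ j})"
    unfolding distinct_points_def by auto
  moreover have "open (\<Inter>i. \<Inter>j\<in>- {i}. {z :: complex ^ 'n. z $ i \<noteq> z $ j})"
    by (intro open_INT finite ballI open_Collect_neq continuous_intros)
  ultimately show ?thesis by simp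
qed

lemma open_cubic_flow_dom_joint:
  "open {w :: real \<times> (complex ^ 'n). snd w \<in> cubic_flow_dom (fst w)}"
proof -
  have "{w :: real \<times> (complex ^ 'n). snd w \<in> cubic_flow_dom (fst w)}
      = (UNIV \<times> distinct_points) \<inter> (\<Inter>i. {w. 0 < Re (cubic_disc (fst w) (snd w $ i))})"
    unfolding cubic_flow_dom_def by auto
  moreover have "open ((UNIV \<times> distinct_points) \<inter>
      (\<Inter>i. {w :: real \<times> (complex ^ 'n). 0 < Re (cubic_disc (fst w) (snd w $ i))}))"
    by (intro open_Int open_Times open_UNIV open_distinct_points open_INT finite ballI
        open_Collect_less continuous_intros)
  ultimately show ?thesis by simp
qed

lemma open_cubic_flow_dom: "open (cubic_flow_dom t)"
  unfolding cubic_flow_dom_def Collect_conj_eq Collect_all_eq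
  by (intro open_Int open_INT finite ballI open_Collect_less continuous_intros)
    (simp add: open_distinct_points)

lemma lift_flow_has_derivative:
  assumes "z \<in> cubic_flow_dom t"
  shows "((\<lambda>w. lift_flow (fst w) (snd w)) has_derivative
     (\<lambda>h. \<chi> i. snd h $ i / csqrt (cubic_disc t (z $ i)) ^ 3 + fst h *\<^sub>R (\<i> * cubic_flow t (z $ i) ^ 3)))
     (at (t, z))"
proof (rule has_derivative_vec_lambda)
  fix i
  have "((\<lambda>w. (fst w, snd w $ i)) has_derivative (\<lambda>h. (fst h, snd h $ i))) (at (t, z))"
    by (intro bounded_linear_imp_has_derivative bounded_linear_Pair bounded_linear_fst
        bounded_linear_compose[OF bounded_linear_vec_nth bounded_linear_snd])
  from has_derivative_compose[OF this, of "\<lambda>w. cubic_flow (fst w) (snd w)"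
      "\<lambda>h. snd h / csqrt (cubic_disc t (z $ i)) ^ 3 + fst h *\<^sub>R (\<i> * cubic_flow t (z $ i) ^ 3)"]
  show "((\<lambda>w. cubic_flow (fst w) (snd w $ i)) has_derivative
     (\<lambda>h. snd h $ i / csqrt (cubic_disc t (z $ i)) ^ 3 + fst h *\<^sub>R (\<i> * cubic_flow t (z $ i) ^ 3))) (at (t, z))"
    using cubic_flow_has_derivative[of t "z $ i"] assms by (simp add: cubic_flow_dom_def)
qed

text \<open>Landmarks cannot merge, since the flow for time \<open>-t\<close> recovers each of
  them.\<close>

lemma lift_flow_in_distinct_points:
  assumes "z \<in> cubic_flow_dom t"
  shows "lift_flow t z \<in> distinct_points"
proof -
  have "cubic_flow t (z $ i) \<noteq> cubic_flow t (z $ j)" if "i \<noteq> j" for i j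
    using assms that cubic_flow_inverse[of t "z $ i"] cubic_flow_inverse[of t "z $ j"]
    unfolding cubic_flow_dom_def distinct_points_def by force
  then show ?thesis unfolding distinct_points_def by simp
qed

lemma lift_flow_in_dom:
  assumes "z \<in> cubic_flow_dom t"
  shows "lift_flow t z \<in> cubic_flow_dom (-t)"
proof -
  have "Re (cubic_disc (- t) (cubic_flow t (z $ i))) > 0" for i
    using assms cubic_disc_flow[of t "z $ i"] Re_inverse_pos[of "cubic_disc t (z $ i)"]
    unfolding cubic_flow_dom_def by simp
  then show ?thesis
    using lift_flow_in_distinct_points[OF assms] by (simp add: cubic_flow_dom_def)
qed

lemma lift_flow_inverse: "z \<in> cubic_flow_dom t \<Longrightarrow> lift_flow (-t) (lift_flow t z) = z"
  by (simp add: cubic_flow_dom_def vec_eq_iff cubic_flow_inverse)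

text \<open>The discriminant is affine in time and equals 1 at time 0, so its real part at time
  \<open>s * t\<close> is a convex combination of 1 and a positive number. The whole trajectory up
  to time \<open>t\<close> is therefore covered.\<close>

lemma cubic_flow_dom_scale:
  assumes "z \<in> cubic_flow_dom t" "s \<in> {0..1}"
  shows "z \<in> cubic_flow_dom (s * t)"
proof -
  have "Re (cubic_disc (s * t) (z $ i)) > 0" for i
  proof -
    have "Re (cubic_disc (s * t) (z $ i)) = (1 - s) + s * Re (cubic_disc t (z $ i))"
      by (simp add: cubic_disc_def algebra_simps)
    moreover have "Re (cubic_disc t (z $ i)) > 0" using assms(1) by (simp add: cubic_flow_dom_def)
    ultimately show ?thesis using assms(2)
      by (cases "s = 0") (auto intro!: add_nonneg_pos)
  qed
  then show ?thesis using assms(1) by (simp add: cubic_flow_dom_def)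
qed

lemma reach_translation:
  assumes "z \<in> distinct_points"
  shows "reach z (z + s *\<^sub>R 1)"
proof -
  have "reach (z + (0 * s) *\<^sub>R 1) (z + (1 * s) *\<^sub>R 1)"
  proof (rule steers_C1[where \<gamma>' = "\<lambda>_. s *\<^sub>R 1"])
    fix t :: real
    show "((\<lambda>t. z + (t * s) *\<^sub>R 1) has_vector_derivative s *\<^sub>R 1) (at t)"
      by (auto intro!: derivative_eq_intros)
    show "z + (t * s) *\<^sub>R 1 \<in> distinct_points" using assms by (simp add: distinct_points_def)
    show "s *\<^sub>R 1 \<in> cubic_span (z + (t * s) *\<^sub>R 1)"
      unfolding cubic_span_def by (intro span_scale span_base) simp
  qed (intro continuous_intros)
  then show ?thesis by simp
qed

lemma reach_lift_flow:
  assumes "z \<in> cubic_flow_dom t"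
  shows "reach z (lift_flow t z)"
proof -
  let ?v = "\<lambda>s. t *\<^sub>R (\<chi> i. \<i> * (lift_flow (s * t) z $ i) ^ 3)"
  have d: "((\<lambda>s. lift_flow (s * t) z) has_vector_derivative ?v s) (at s)" if "s \<in> {0..1}" for s
  proof -
    have "((\<lambda>s. (s * t, z)) has_derivative (\<lambda>h. (h * t, 0))) (at s)"
      by (auto intro!: derivative_eq_intros)
    from has_derivative_compose[OF this, of "\<lambda>w. lift_flow (fst w) (snd w)"]
      lift_flow_has_derivative[OF cubic_flow_dom_scale[OF assms that]]
    have "((\<lambda>s. lift_flow (s * t) z) has_derivative
        (\<lambda>h. \<chi> i. (h * t) *\<^sub>R (\<i> * cubic_flow (s * t) (z $ i) ^ 3))) (at s)" by fastforce
    then show ?thesis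
      unfolding has_vector_derivative_def by (simp add: scaleR_vec_def)
  qed
  \<comment> \<open>The endpoints are written as values at the parameters 0 and 1, the form in which
    \<open>steers_C1\<close> concludes.\<close>
  have "reach (lift_flow (0 * t) z) (lift_flow (1 * t) z)"
  proof (rule steers_C1[where \<gamma>' = ?v])
    show "continuous_on {0..1} ?v"
    proof -
      have "continuous_on {0..1} (\<lambda>s. lift_flow (s * t) z)"
        using d by (meson continuous_at_imp_continuous_on has_vector_derivative_continuous)
      then have "continuous_on {0..1} (\<lambda>s. lift_flow (s * t) z $ i)" for i
        by (rule continuous_on_component)
      then show ?thesis by (intro continuous_intros) simp
    qed
    fix s :: real assume s: "s \<in> {0..1}"
    show "((\<lambda>s. lift_flow (s * t) z) has_vector_derivative ?v s) (at s)" using d[OF s] .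
    show "lift_flow (s * t) z \<in> distinct_points"
      using lift_flow_in_distinct_points[OF cubic_flow_dom_scale[OF assms s]] .
    show "?v s \<in> cubic_span (lift_flow (s * t) z)"
      unfolding cubic_span_def by (intro span_scale span_base) simp
  qed
  then show ?thesis by simp
qed

section \<open>Directions available at a configuration\<close>

lemma one_directions:
  fixes q :: "complex ^ 'n"
  assumes "q \<in> distinct_points"
  shows "1 \<in> directions reach q"
proof (rule directionsI)
  show "open (UNIV \<times> distinct_points :: (real \<times> (complex ^ 'n)) set)"
    by (intro open_Times open_UNIV open_distinct_points)
  show "((\<lambda>w. snd w + fst w *\<^sub>R 1) has_derivative (\<lambda>w. snd w + fst w *\<^sub>R (1 :: complex ^ 'n))) (at (0, q))"
    by (intro bounded_linear_imp_has_derivative bounded_linear_add bounded_linear_snd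
        bounded_linear_compose[OF bounded_linear_scaleR_left bounded_linear_fst])
qed (use assms reach_translation in \<open>auto intro!: continuous_intros\<close>)

lemma cubic_directions:
  fixes q :: "complex ^ 'n"
  assumes "q \<in> distinct_points"
  shows "(\<chi> i. \<i> * (q $ i) ^ 3) \<in> directions reach q"
proof (rule directionsI)
  let ?U = "{w :: real \<times> (complex ^ 'n). snd w \<in> cubic_flow_dom (fst w)}"
  show "open ?U" by (rule open_cubic_flow_dom_joint)
  show "continuous_on ?U (\<lambda>w. lift_flow (fst w) (snd w))"
    using lift_flow_has_derivative has_derivative_continuous
    by (intro continuous_at_imp_continuous_on ballI) fastforce
  show q: "(0, q) \<in> ?U" using assms by (simp add: cubic_flow_dom_def)
  show "((\<lambda>w. lift_flow (fst w) (snd w)) has_derivative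
      (\<lambda>w. snd w + fst w *\<^sub>R (\<chi> i. \<i> * (q $ i) ^ 3))) (at (0, q))"
    using lift_flow_has_derivative[of q 0] q
    by (simp add: plus_vec_def scaleR_vec_def)
qed (use reach_lift_flow in auto)

text \<open>Translations have the identity as differential, so conjugation by them leaves vectors
  unchanged.\<close>

lemma directions_translate:
  assumes "q \<in> distinct_points" "v \<in> directions reach (q + s *\<^sub>R 1)"
  shows "v \<in> directions reach q"
proof -
  show ?thesis
    by (rule directions_pullback[OF transp_reach, where \<Phi> = "\<lambda>p. p + s *\<^sub>R 1" and \<Psi> = "\<lambda>p. p + (-s) *\<^sub>R 1"
          and V = distinct_points and W = distinct_points and v = v
          and \<Phi>' = "\<lambda>v. v" and \<Psi>' = "\<lambda>v. v"])
      (use assms reach_translation[of _ s] reach_translation[of _ "-s"] open_distinct_points in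
        \<open>auto intro!: continuous_intros derivative_eq_intros simp: distinct_points_def\<close>)
qed

text \<open>The differential of the return map \<open>lift_flow (-t)\<close> divides by the cubed
  root of the discriminant at the image point. That discriminant is
  \<open>inverse (cubic_disc t (q $ i))\<close>, so the division becomes a multiplication.\<close>

lemma directions_flow:
  assumes q: "q \<in> cubic_flow_dom t" and v: "v \<in> directions reach (lift_flow t q)"
  shows "(\<chi> i. csqrt (cubic_disc t (q $ i)) ^ 3 * v $ i) \<in> directions reach q"
proof -
  have der: "(lift_flow s has_derivative (\<lambda>h. \<chi> i. h $ i / csqrt (cubic_disc s (z $ i)) ^ 3)) (at z)"
    if "z \<in> cubic_flow_dom s" for s and z :: "complex ^ 'n"
  proof -
    have "((\<lambda>z. (s, z)) has_derivative (\<lambda>h. (0, h))) (at z)"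
      by (auto intro!: derivative_eq_intros)
    from has_derivative_compose[OF this, of "\<lambda>w. lift_flow (fst w) (snd w)"]
      lift_flow_has_derivative[OF that]
    show ?thesis by fastforce
  qed
  have cont: "continuous_on (cubic_flow_dom s) (lift_flow s)" for s
    using der has_derivative_continuous by (intro continuous_at_imp_continuous_on ballI) blast
  have pos: "Re (cubic_disc t (q $ i)) > 0" for i using q by (simp add: cubic_flow_dom_def)
  then have nz: "cubic_disc t (q $ i) \<noteq> 0" for i by (metis less_irrefl zero_complex.sel(1))
  have "(\<lambda>v. \<chi> i. v $ i * csqrt (cubic_disc t (q $ i)) ^ 3) v \<in> directions reach q"
  proof (rule directions_pullback[OF transp_reach, where \<Phi> = "lift_flow t" and \<Psi> = "lift_flow (-t)"
          and V = "cubic_flow_dom t" and W = "cubic_flow_dom (-t)" and v = v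
          and \<Psi>' = "\<lambda>v. \<chi> i. v $ i * csqrt (cubic_disc t (q $ i)) ^ 3"
          and \<Phi>' = "\<lambda>h. \<chi> i. h $ i / csqrt (cubic_disc t (q $ i)) ^ 3"])
    show "(lift_flow (-t) has_derivative (\<lambda>v. \<chi> i. v $ i * csqrt (cubic_disc t (q $ i)) ^ 3)) (at (lift_flow t q))"
      using der[OF lift_flow_in_dom[OF q]] cubic_disc_flow[OF pos] csqrt_inverse_Re_pos[OF pos]
      by (simp add: divide_inverse power_inverse)
    show "lift_flow (-t) (lift_flow t q) = q" by (rule lift_flow_inverse[OF q])
  qed (use assms der cont open_cubic_flow_dom lift_flow_in_dom reach_lift_flow nz in
       \<open>auto simp: vec_eq_iff\<close>)
  then show ?thesis by (simp add: mult.commute)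
qed

section \<open>Spanning directions and controllability\<close>

lemma directions_subspace:
  "q \<in> distinct_points \<Longrightarrow> subspace (directions reach q)"
  using subspace_directions[OF transp_reach] one_directions by blast

text \<open>The third difference of \<open>s \<mapsto> (z + s)\<^sup>3\<close> is the constant 6.\<close>

lemma i_directions:
  fixes q :: "complex ^ 'n"
  assumes "q \<in> distinct_points"
  shows "(\<chi> i. \<i>) \<in> directions reach q"
proof -
  let ?c = "\<lambda>s. \<chi> i. \<i> * ((q + s *\<^sub>R 1) $ i) ^ 3"
  have "q + s *\<^sub>R 1 \<in> distinct_points" for s
    using assms by (simp add: distinct_points_def)
  then have c: "?c s \<in> directions reach q" for s
    using directions_translate[OF assms cubic_directions] by blast
  have "(1/6) *\<^sub>R (?c 3 - 3 *\<^sub>R ?c 2 + 3 *\<^sub>R ?c 1 - ?c 0) \<in> directions reach q"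
    using c directions_subspace[OF assms] by (intro subspace_scale subspace_add subspace_diff)
  also have "(1/6) *\<^sub>R (?c 3 - 3 *\<^sub>R ?c 2 + 3 *\<^sub>R ?c 1 - ?c 0) = (\<chi> i. \<i>)"
    by (simp add: vec_eq_iff algebra_simps power3_eq_cube scaleR_conv_of_real[where 'a = complex])
  finally show ?thesis .
qed

section \<open>Vanishing sums of half-integer powers\<close>

text \<open>This is the power rule for the exponent \<open>3/2 - k\<close>, written so that
  differentiation just raises \<open>k\<close> by one.\<close>

lemma csqrt_cube_div_power_has_field_derivative:
  assumes W: "W \<notin> \<real>\<^sub>\<le>\<^sub>0"
  shows "((\<lambda>w. csqrt w ^ 3 / w ^ k) has_field_derivative
     (3/2 - of_nat k) * (csqrt W ^ 3 / W ^ Suc k)) (at W)"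
proof -
  let ?S = "csqrt W"
  have nz: "W \<noteq> 0" "?S \<noteq> 0" using W by auto
  have S3: "?S ^ 3 = W * ?S" by (metis power2_csqrt power3_eq_cube power2_eq_square)
  have "((\<lambda>w. csqrt w ^ 3) has_field_derivative 3/2 * ?S) (at W)"
    using DERIV_power[OF has_field_derivative_csqrt[OF W], of 3] nz
    by (simp add: field_simps power2_eq_square)
  from DERIV_divide[OF this DERIV_power[OF DERIV_ident, of k]]
  have "((\<lambda>w. csqrt w ^ 3 / w ^ k) has_field_derivative
      (3/2 * ?S * W ^ k - ?S ^ 3 * (of_nat k * W ^ (k - 1))) / (W ^ k * W ^ k)) (at W)"
    using nz by (simp add: mult_ac)
  moreover have "(3/2 * ?S * W ^ k - ?S ^ 3 * (of_nat k * W ^ (k - 1))) / (W ^ k * W ^ k)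
      = (3/2 - of_nat k) * (?S ^ 3 / W ^ Suc k)"
    unfolding S3 using nz by (cases k) (simp_all add: field_simps)
  ultimately show ?thesis by simp
qed

lemma vanishing_half_power_sum:
  fixes a \<mu> :: "'n::finite \<Rightarrow> complex"
  assumes e: "e > 0"
    and re: "\<And>t i. \<bar>t\<bar> < e \<Longrightarrow> Re (1 - \<i> * of_real t * a i) > 0"
    and zero: "\<And>t. \<bar>t\<bar> < e \<Longrightarrow> (\<Sum>i\<in>UNIV. \<mu> i * csqrt (1 - \<i> * of_real t * a i) ^ 3) = 0"
  shows "(\<Sum>i\<in>UNIV. \<mu> i * a i ^ k) = 0"
proof -
  let ?w = "\<lambda>i t. 1 - \<i> * of_real t * a i"
  let ?g = "\<lambda>k t. \<Sum>i\<in>UNIV. \<mu> i * a i ^ k * (csqrt (?w i t) ^ 3 / ?w i t ^ k)"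
  \<comment> \<open>Vanishing on the whole interval, not only at 0, is what allows each induction
    step to differentiate.\<close>
  have "\<forall>t. \<bar>t\<bar> < e \<longrightarrow> ?g k t = 0"
  proof (induction k)
    case 0
    then show ?case using zero by simp
  next
    case (Suc k)
    show ?case
    proof (intro allI impI)
      fix t :: real assume t: "\<bar>t\<bar> < e"
      let ?d = "(3/2 - of_nat k) * (- \<i>)"
      have deriv: "((\<lambda>t. csqrt (?w i t) ^ 3 / ?w i t ^ k) has_vector_derivative
          ?d * a i * (csqrt (?w i t) ^ 3 / ?w i t ^ Suc k)) (at t)" for i
      proof -
        have "((\<lambda>x. 1 - \<i> * x * a i) has_field_derivative - \<i> * a i) (at (of_real t))"
          by (auto intro!: derivative_eq_intros)
        from DERIV_chain2[OF csqrt_cube_div_power_has_field_derivative this]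
        have "((\<lambda>x. csqrt (1 - \<i> * x * a i) ^ 3 / (1 - \<i> * x * a i) ^ k) has_field_derivative
          ?d * a i * (csqrt (?w i t) ^ 3 / ?w i t ^ Suc k)) (at (of_real t))"
          using Re_pos_imp_not_nonpos_Reals[OF re[OF t]] by (simp add: mult_ac)
        from has_vector_derivative_real_field[OF this] show ?thesis .
      qed
      have A: "(?g k has_vector_derivative
          (\<Sum>i\<in>UNIV. \<mu> i * a i ^ k * (?d * a i * (csqrt (?w i t) ^ 3 / ?w i t ^ Suc k)))) (at t)"
        by (intro has_vector_derivative_sum has_vector_derivative_mult_right deriv)
      have B: "(\<Sum>i\<in>UNIV. \<mu> i * a i ^ k * (?d * a i * (csqrt (?w i t) ^ 3 / ?w i t ^ Suc k)))
          = ?d * ?g (Suc k) t"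
        unfolding sum_distrib_left by (intro sum.cong) (simp_all add: mult_ac)
      have C: "(?g k has_vector_derivative 0) (at t)"
        by (rule has_vector_derivative_transform_within_open[of "\<lambda>_. 0" _ _ "{-e<..<e}"])
          (use t Suc.IH in \<open>auto simp: abs_less_iff\<close>)
      have "?d * ?g (Suc k) t = 0"
        unfolding B[symmetric] by (rule vector_derivative_unique_at[OF A C])
      \<comment> \<open>The exponent \<open>3/2 - k\<close> is never zero because 3 is odd; for an
        integer exponent the chain of derivatives would break off.\<close>
      moreover have "?d \<noteq> 0"
      proof
        assume "?d = 0"
        then have "(3 :: complex) = of_nat (2 * k)" by (simp add: field_simps)
        then have "3 = 2 * k" by (metis of_nat_eq_iff of_nat_numeral)
        then show False by presburger
      qed
      ultimately show "?g (Suc k) t = 0" using mult_eq_0_iff[THEN iffD1] by blast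
    qed
  qed
  \<comment> \<open>At \<open>t = 0\<close> every base \<open>?w i t\<close> is 1, so only the power
    sum remains.\<close>
  from this[rule_format, of 0] show ?thesis using e by simp
qed

text \<open>By linearity the sums vanish with any polynomial in place of the powers. The one with
  roots at all \<open>a j\<close> for \<open>j \<noteq> i\<close> isolates the coefficient
  \<open>\<mu> i\<close>.\<close>

lemma vanishing_power_sums:
  fixes a \<mu> :: "'n::finite \<Rightarrow> 'a::field"
  assumes "inj a" and "\<And>k. (\<Sum>i\<in>UNIV. \<mu> i * a i ^ k) = 0"
  shows "\<mu> i = 0"
proof -
  let ?p = "\<Prod>j\<in>-{i}. [:- a j, 1:]"
  have p: "poly ?p x = (\<Prod>j\<in>-{i}. x - a j)" for x by (simp add: poly_prod)
  have "(\<Sum>j\<in>UNIV. \<mu> j * poly ?p (a j)) = (\<Sum>k\<le>degree ?p. coeff ?p k * (\<Sum>j\<in>UNIV. \<mu> j * a j ^ k))"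
    unfolding poly_altdef sum_distrib_left
    by (subst sum.swap) (intro sum.cong refl, simp add: mult_ac)
  also have "\<dots> = 0" using assms(2) by simp
  also have "(\<Sum>j\<in>UNIV. \<mu> j * poly ?p (a j)) = \<mu> i * poly ?p (a i)"
  proof -
    have "poly ?p (a j) = 0" if "j \<noteq> i" for j
      unfolding p using that by (intro prod_zero) auto
    then show ?thesis by (subst sum.remove[of _ i]) auto
  qed
  finally have "\<mu> i * poly ?p (a i) = 0" .
  moreover have "poly ?p (a i) \<noteq> 0"
    unfolding p using assms(1) by (auto simp: inj_def)
  ultimately show ?thesis by simp
qed

text \<open>Equal squares mean equal or opposite shifted landmarks. The opposite case fixes
  \<open>s\<close> as minus the real part of a midpoint, which rules out finitely many
  values.\<close>

lemma shift_squares_distinct: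
  fixes z :: "complex ^ 'n"
  assumes "z \<in> distinct_points"
  shows "\<exists>s. inj (\<lambda>i. 2 * ((z + s *\<^sub>R 1) $ i)\<^sup>2)"
proof -
  have "finite (\<Union>i j. {Re (- (z $ i + z $ j) / 2)})" by auto
  then obtain s where s: "s \<notin> (\<Union>i j. {Re (- (z $ i + z $ j) / 2)})"
    using ex_new_if_finite[OF infinite_UNIV_char_0] by blast
  have "inj (\<lambda>i. 2 * ((z + s *\<^sub>R 1) $ i)\<^sup>2)"
  proof (rule injI)
    fix i j assume "2 * ((z + s *\<^sub>R 1) $ i)\<^sup>2 = 2 * ((z + s *\<^sub>R 1) $ j)\<^sup>2"
    then have "(z $ i + of_real s)\<^sup>2 = (z $ j + of_real s)\<^sup>2"
      by (simp add: scaleR_conv_of_real[where 'a = complex])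
    then consider "z $ i = z $ j" | "z $ i + of_real s = - (z $ j + of_real s)"
      by (auto simp: power2_eq_iff)
    then show "i = j"
    proof cases
      case 1
      then show ?thesis using assms unfolding distinct_points_def by blast
    next
      case 2
      then have "Re (z $ i) + s = - (Re (z $ j) + s)" by (simp add: complex_eq_iff)
      then have "s = Re (- (z $ i + z $ j) / 2)" by simp
      then show ?thesis using s by blast
    qed
  qed
  then show ?thesis by blast
qed

lemma directions_eq_UNIV:
  fixes z :: "complex ^ 'n"
  assumes z: "z \<in> distinct_points"
  shows "directions reach z = UNIV"
proof (rule ccontr)
  let ?D = "directions reach z"
  assume "?D \<noteq> UNIV"
  moreover have sD: "span ?D = ?D" using directions_subspace[OF z] by (simp add: span_eq_iff)
  ultimately have "span ?D \<subset> span UNIV" unfolding sD span_UNIV by blast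
  from orthogonal_to_subspace_exists_gen[OF this]
  obtain \<nu> where \<nu>: "\<nu> \<noteq> 0" "\<And>v. v \<in> ?D \<Longrightarrow> \<nu> \<bullet> v = 0"
    unfolding orthogonal_def sD by blast
  \<comment> \<open>Conjugation expresses the real inner product as
    \<open>\<nu> \<bullet> v = Re (\<Sum>i. ?\<mu> i * v $ i)\<close>.\<close>
  let ?\<mu> = "\<lambda>i. cnj (\<nu> $ i)"
  obtain s where inj: "inj (\<lambda>i. 2 * ((z + s *\<^sub>R 1) $ i)\<^sup>2)"
    using shift_squares_distinct[OF z] by blast
  define y where "y = z + s *\<^sub>R 1"
  have y: "y \<in> distinct_points" using z by (simp add: y_def distinct_points_def)
  let ?a = "\<lambda>i. 2 * (y $ i)\<^sup>2"
  have w: "cubic_disc t (y $ i) = 1 - \<i> * of_real t * ?a i" for t i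
    by (simp add: cubic_disc_def)
  have sum0: "(\<Sum>i\<in>UNIV. ?\<mu> i * csqrt (cubic_disc t (y $ i)) ^ 3) = 0"
    if t: "y \<in> cubic_flow_dom t" for t
  proof -
    have y': "lift_flow t y \<in> distinct_points" by (rule lift_flow_in_distinct_points[OF t])
    let ?S = "\<lambda>i. csqrt (cubic_disc t (y $ i)) ^ 3"
    \<comment> \<open>The constants \<open>1\<close> and \<open>\<i>\<close> at
      \<open>lift_flow t y\<close> are pulled back to \<open>y\<close> by the flow, then to
      \<open>z\<close> by the translation. Orthogonality to the two results kills the real and the
      imaginary part of the sum.\<close>
    have "(\<chi> i. ?S i) \<in> ?D" "(\<chi> i. ?S i * \<i>) \<in> ?D"
      using directions_flow[OF t one_directions[OF y']] directions_flow[OF t i_directions[OF y']]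
        directions_translate[OF z] unfolding y_def by auto
    from this[THEN \<nu>(2)] have "Re (\<Sum>i\<in>UNIV. ?\<mu> i * ?S i) = 0" "Im (\<Sum>i\<in>UNIV. ?\<mu> i * ?S i) = 0"
      by (simp_all add: inner_vec_def inner_complex_def sum.distrib sum_subtractf sum_negf algebra_simps)
    then show ?thesis by (simp add: complex_eq_iff)
  qed
  obtain e where e: "e > 0" "\<And>t. \<bar>t\<bar> < e \<Longrightarrow> y \<in> cubic_flow_dom t"
  proof -
    have "open ((\<lambda>t. (t, y)) -` {w :: real \<times> (complex ^ 'n). snd w \<in> cubic_flow_dom (fst w)})"
      by (intro open_vimage open_cubic_flow_dom_joint continuous_intros)
    moreover have "0 \<in> (\<lambda>t. (t, y)) -` {w. snd w \<in> cubic_flow_dom (fst w)}"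
      using y by (simp add: cubic_flow_dom_def)
    ultimately obtain e where "e > 0" "ball 0 e \<subseteq> (\<lambda>t. (t, y)) -` {w. snd w \<in> cubic_flow_dom (fst w)}"
      using openE by blast
    then show thesis by (intro that[of e]) (auto simp: dist_real_def subset_iff)
  qed
  have "(\<Sum>i\<in>UNIV. ?\<mu> i * ?a i ^ k) = 0" for k
  proof (rule vanishing_half_power_sum[OF e(1)])
    fix t :: real and i assume "\<bar>t\<bar> < e"
    from e(2)[OF this] show "0 < Re (1 - \<i> * of_real t * ?a i)"
      unfolding w[symmetric] cubic_flow_dom_def by blast
  next
    fix t :: real assume "\<bar>t\<bar> < e"
    from sum0[OF e(2)[OF this]] show "(\<Sum>i\<in>UNIV. ?\<mu> i * csqrt (1 - \<i> * of_real t * ?a i) ^ 3) = 0"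
      unfolding w .
  qed
  from vanishing_power_sums[OF _ this] inj have "?\<mu> i = 0" for i unfolding y_def by blast
  then have "\<nu> = 0" by (simp add: vec_eq_iff)
  with \<nu>(1) show False by contradiction
qed

text \<open>Reachability is an equivalence relation with open classes, so a connected set lies in
  one class. A complex parameter is essential: removing finitely many points from the plane, unlike
  from a real line, keeps it connected.\<close>

lemma reach_distinct_points:
  fixes x y :: "complex ^ 'n"
  assumes x: "x \<in> distinct_points" and y: "y \<in> distinct_points"
  shows "reach x y"
proof -
  let ?l = "\<lambda>\<zeta>. \<chi> i. x $ i + \<zeta> * (y $ i - x $ i)"
  let ?C = "UNIV - {\<zeta>. ?l \<zeta> \<notin> distinct_points}"
  \<comment> \<open>Two landmarks \<open>i \<noteq> j\<close> collide for at most one \<open>\<zeta>\<close>, as they are apart at \<open>\<zeta> = 0\<close>.\<close>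
  have fin: "finite {\<zeta>. ?l \<zeta> \<notin> distinct_points}"
  proof (rule finite_subset)
    show "{\<zeta>. ?l \<zeta> \<notin> distinct_points} \<subseteq>
        (\<Union>i j. {(x $ j - x $ i) / ((y $ i - x $ i) - (y $ j - x $ j))})"
    proof clarify
      fix \<zeta> assume "?l \<zeta> \<notin> distinct_points"
      then obtain i j where ij: "i \<noteq> j" "x $ i + \<zeta> * (y $ i - x $ i) = x $ j + \<zeta> * (y $ j - x $ j)"
        unfolding distinct_points_def by auto
      then have eq: "\<zeta> * ((y $ i - x $ i) - (y $ j - x $ j)) = x $ j - x $ i" by (simp add: algebra_simps)
      moreover have "x $ j - x $ i \<noteq> 0" using x ij(1) unfolding distinct_points_def by auto
      \<comment> \<open>A zero denominator would force \<open>x $ j - x $ i = 0\<close>, so the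
        division is genuine.\<close>
      ultimately have "\<zeta> = (x $ j - x $ i) / ((y $ i - x $ i) - (y $ j - x $ j))"
        by (metis eq_divide_eq mult_zero_right)
      then show "\<zeta> \<in> (\<Union>i j. {(x $ j - x $ i) / ((y $ i - x $ i) - (y $ j - x $ j))})" by blast
    qed
  qed simp
  have "connected ?C" by (intro connected_open_delete_finite fin) auto
  then have "connected (?l ` ?C)"
    by (intro connected_continuous_image continuous_intros)
  then show ?thesis
  proof (rule connected_equivalence_relation[where R = reach])
    show "x \<in> ?l ` ?C"
      using x by (intro image_eqI[of _ _ 0]) auto
    show "y \<in> ?l ` ?C"
      using y by (intro image_eqI[of _ _ 1]) auto
    show "reach v u" if "reach u v" for u v using steers_sym[OF subspace_cubic_span that] .
    show "reach u w" if "reach u v" "reach v w" for u v w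
      using steers_trans[OF subspace_cubic_span that] .
    fix u assume u: "u \<in> ?l ` ?C"
    then have "u \<in> distinct_points" by auto
    then have "u \<in> interior {p. reach u p}"
      using directions_UNIV_imp_interior[OF transp_reach directions_eq_UNIV] by blast
    then show "\<exists>T. openin (top_of_set (?l ` ?C)) T \<and> u \<in> T \<and> (\<forall>v\<in>T. reach u v)"
      using u interior_subset
      by (intro exI[of _ "?l ` ?C \<inter> interior {p. reach u p}"] conjI openin_open_Int open_interior) auto
  qed
qed

theorem theorem3p3:
  shows "completely_controllable (landmark_manifold :: (real ^ 2 ^ 'n) set)
           (\<lambda>x. span {landmark_lift X\<^sub>0\<^sub>0 x, landmark_lift X\<^sub>1\<^sub>3 x})"
proof -
  \<comment> \<open>\<open>T\<close> is the real-linear identification of the complex plane with the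
    real one, applied to each landmark; it turns \<open>\<i> z^3\<close> into
    \<open>X\<^sub>1\<^sub>3\<close>.\<close>
  define T :: "complex ^ 'n \<Rightarrow> real ^ 2 ^ 'n" where "T = (\<lambda>z. \<chi> i. vector [Re (z $ i), Im (z $ i)])"
  define E :: "real ^ 2 ^ 'n \<Rightarrow> (real ^ 2 ^ 'n) set"
    where "E = (\<lambda>x. span {landmark_lift X\<^sub>0\<^sub>0 x, landmark_lift X\<^sub>1\<^sub>3 x})"
  have linT: "linear T"
    by (rule linearI) (simp_all add: T_def vec_eq_iff forall_2)
  have T1: "T 1 = landmark_lift X\<^sub>0\<^sub>0 x" for x
    by (simp add: T_def vec_eq_iff forall_2 landmark_lift_def X\<^sub>0\<^sub>0_def)
  have T3: "T (\<chi> i. \<i> * (z $ i) ^ 3) = landmark_lift X\<^sub>1\<^sub>3 (T z)" for z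
    by (simp add: T_def vec_eq_iff forall_2 landmark_lift_def X\<^sub>1\<^sub>3_def Let_def
        power3_eq_cube power2_eq_square algebra_simps)
  have TE: "T ` cubic_span z \<subseteq> E (T z)" for z
    unfolding cubic_span_def E_def by (simp add: linear_span_image[OF linT, symmetric] T1[of "T z"] T3)
  have TM: "T ` distinct_points \<subseteq> landmark_manifold"
    by (auto simp: T_def distinct_points_def landmark_manifold_def vec_eq_iff forall_2 complex_eq_iff)
  have surj: "\<exists>z\<in>distinct_points. x = T z" if "x \<in> landmark_manifold" for x
  proof
    let ?z = "\<chi> i. Complex (x $ i $ 1) (x $ i $ 2)"
    show "x = T ?z" by (simp add: T_def vec_eq_iff forall_2)
    show "?z \<in> distinct_points"
      using that by (auto simp: distinct_points_def landmark_manifold_def vec_eq_iff forall_2)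
  qed
  have "orbit_of landmark_manifold E q = landmark_manifold" if q: "q \<in> landmark_manifold" for q
  proof
    show "orbit_of landmark_manifold E q \<subseteq> landmark_manifold"
      unfolding orbit_of_def horizontal_curve_def by auto
    show "landmark_manifold \<subseteq> orbit_of landmark_manifold E q"
    proof
      fix p :: "real ^ 2 ^ 'n" assume "p \<in> landmark_manifold"
      then obtain y z where "y \<in> distinct_points" "z \<in> distinct_points" "q = T y" "p = T z"
        using surj q by blast
      then show "p \<in> orbit_of landmark_manifold E q"
        using steers_imp_orbit steers_linear_image[where E = cubic_span and E' = E, OF linT TM TE] reach_distinct_points by blast
    qed
  qed
  then show ?thesis unfolding completely_controllable_def E_def by blast
qed

end
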